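(* Let $\lambda/\mu$ and $\nu/\rho$ be skew shapes such that the skew shape $(\lambda\vee\nu)/(\mu\wedge\rho)$ is connected. Then $$s_{\lambda/\mu}\cdot s_{\nu/\rho}\ =\ s_{(\lambda\vee\nu)/(\mu\vee\rho)}\cdot s_{(\lambda\wedge\nu)/(\mu\wedge\rho)}$$ (as symmetric functions) if and only if either ($\lambda\subseteq\nu$ and $\mu\subseteq\rho$) or ($\nu\subseteq\lambda$ and $\rho\subseteq\mu$).
   Context: A partition is a sequence $\lambda=(\lambda_1\ge\lambda_2\ge\dots)$ of nonnegative integers with finitely many nonzero terms, identified with its Young diagram $\{(i,j): i\ge 1,\ 1\le j\le\lambda_i\}$. Write $\mu\subseteq\lambda$ if $\mu_i\le\lambda_i$ for all $i$. A skew shape $\lambda/\mu$ is a pair of partitions with $\mu\subseteq\lambda$; its skew Young diagram is the set difference of the two diagrams. A skew shape is connected if the squares of its skew Young diagram are rook-connected, i.e. any two squares are joined by a path of squares of the diagram in which consecutive squares share an edge. For partitions $\alpha,\beta$: $\alpha\vee\beta=(\max\{\alpha_i,\beta_i\})_{i\ge1}$ and $\alpha\wedge\beta=(\min\{\alpha_i,\beta_i\})_{i\ge1}$. A semistandard Young tableau of shape $\lambda/\mu$ is a filling of the squares of $\lambda/\mu$ by positive integers, weakly increasing along rows (in $j$) and strictly increasing down columns (in $i$). The skew Schur function is $s_{\lambda/\mu}(z_1,z_2,\ldots)=\sum_{A}z_1^{m_1(A)}z_2^{m_2(A)}\cdots$, the sum over all semistandard Young tableaux $A$ of shape $\lambda/\mu$,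 where $m_i(A)$ is the number of entries of $A$ equal to $i$. *)

theory Defs
  imports "HOL-Library.Multiset" "HOL-Library.FuncSet"
begin

(* Rows and columns are numbered from 0, so lam i is the part usually written lambda_(i+1).
   On functions nat => nat the library's sup, inf and \<le> are taken pointwise; on partitions
   they are the join, the meet and the containment order. *)

definition is_partition :: "(nat \<Rightarrow> nat) \<Rightarrow> bool" where
  "is_partition lam \<longleftrightarrow> antimono lam \<and> finite {i. lam i \<noteq> 0}"

definition skew_shape :: "(nat \<Rightarrow> nat) \<Rightarrow> (nat \<Rightarrow> nat) \<Rightarrow> bool" where
  "skew_shape lam mu \<longleftrightarrow> is_partition lam \<and> is_partition mu \<and> mu \<le> lam"

definition diagram :: "(nat \<Rightarrow> nat) \<Rightarrow> (nat \<times> nat) set" where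
  "diagram lam = {(i, j). j < lam i}"

definition skew_diagram :: "(nat \<Rightarrow> nat) \<Rightarrow> (nat \<Rightarrow> nat) \<Rightarrow> (nat \<times> nat) set" where
  "skew_diagram lam mu = diagram lam - diagram mu"

fun share_edge :: "nat \<times> nat \<Rightarrow> nat \<times> nat \<Rightarrow> bool" where
  "share_edge (i, j) (i', j') \<longleftrightarrow>
     (i = i' \<and> (j' = Suc j \<or> j = Suc j')) \<or> (j = j' \<and> (i' = Suc i \<or> i = Suc i'))"

definition rook_connected :: "(nat \<times> nat) set \<Rightarrow> bool" where
  "rook_connected D \<longleftrightarrow>
     (\<forall>x\<in>D. \<forall>y\<in>D. (x, y) \<in> {(a, b). a \<in> D \<and> b \<in> D \<and> share_edge a b}\<^sup>*)"

(* The extensional function space makes a filling determined by its values on the diagram. *)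
definition ssyt :: "(nat \<Rightarrow> nat) \<Rightarrow> (nat \<Rightarrow> nat) \<Rightarrow> (nat \<times> nat \<Rightarrow> nat) set" where
  "ssyt lam mu = {T \<in> skew_diagram lam mu \<rightarrow>\<^sub>E {1..}.
     (\<forall>i j j'. (i, j) \<in> skew_diagram lam mu \<longrightarrow> (i, j') \<in> skew_diagram lam mu \<longrightarrow> j < j' \<longrightarrow>
        T (i, j) \<le> T (i, j')) \<and>
     (\<forall>i i' j. (i, j) \<in> skew_diagram lam mu \<longrightarrow> (i', j) \<in> skew_diagram lam mu \<longrightarrow> i < i' \<longrightarrow>
        T (i, j) < T (i', j))}"

(* The multiset of entries: its count at i is the multiplicity m_i. *)
definition content :: "(nat \<Rightarrow> nat) \<Rightarrow> (nat \<Rightarrow> nat) \<Rightarrow> (nat \<times> nat \<Rightarrow> nat) \<Rightarrow> nat multiset" where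
  "content lam mu T = image_mset T (mset_set (skew_diagram lam mu))"

(* Formal power series in the variables z_1, z_2, ... with integer coefficients.  The multiset M
   stands for the monomial in which z_i has exponent count M i, and f M is its coefficient.
   Coefficients at multisets containing 0 are not needed and vanish for skew Schur functions. *)
type_synonym mpower_series = "nat multiset \<Rightarrow> int"

definition mps_mult :: "mpower_series \<Rightarrow> mpower_series \<Rightarrow> mpower_series" (infixl "\<odot>" 70) where
  "f \<odot> g = (\<lambda>M. \<Sum>(A, B) \<in> {(A, B). A + B = M}. f A * g B)"

definition skew_schur :: "(nat \<Rightarrow> nat) \<Rightarrow> (nat \<Rightarrow> nat) \<Rightarrow> mpower_series" where
  "skew_schur lam mu = (\<lambda>M. int (card {T \<in> ssyt lam mu. content lam mu T = M}))"

(* The index sets of the sum and of the cardinality above are finite, so neither takes the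
   default value for infinite sets. *)

lemma finite_mset_decompositions: "finite {(A, B). A + B = (M :: nat multiset)}"
proof (rule finite_subset)
  let ?X = "\<Union>n\<le>size M. multisets_of_size (set_mset M) n"
  show "{(A, B). A + B = M} \<subseteq> ?X \<times> ?X"
    by (auto simp: multisets_of_size_def)
  show "finite (?X \<times> ?X)"
    by auto
qed

lemma finite_skew_diagram:
  assumes "is_partition lam"
  shows "finite (skew_diagram lam mu)"
proof (rule finite_subset)
  show "skew_diagram lam mu \<subseteq> (SIGMA i:{i. lam i \<noteq> 0}. {..<lam i})"
    by (auto simp: skew_diagram_def diagram_def)
  show "finite (SIGMA i:{i. lam i \<noteq> 0}. {..<lam i})"
    using assms by (auto simp: is_partition_def intro!: finite_SigmaI)
qed

lemma finite_ssyt_content: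
  assumes "is_partition lam"
  shows "finite {T \<in> ssyt lam mu. content lam mu T = M}"
proof (rule finite_subset)
  let ?D = "skew_diagram lam mu"
  have fin: "finite ?D"
    by (rule finite_skew_diagram[OF assms])
  show "{T \<in> ssyt lam mu. content lam mu T = M} \<subseteq> ?D \<rightarrow>\<^sub>E set_mset M"
    using fin by (auto simp: ssyt_def content_def PiE_def)
  show "finite (?D \<rightarrow>\<^sub>E set_mset M)"
    using fin by (intro finite_PiE) auto
qed

lemma skew_shape_sup:
  assumes "skew_shape lam mu" "skew_shape nu rho"
  shows "skew_shape (sup lam nu) (sup mu rho)"
proof -
  have "is_partition (sup a b)" if "is_partition a" "is_partition b" for a b
  proof -
    have "{i. sup a b i \<noteq> 0} = {i. a i \<noteq> 0} \<union> {i. b i \<noteq> 0}"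
      by (auto simp: sup_nat_def)
    moreover have "antimono (sup a b)"
      using that unfolding is_partition_def antimono_def sup_fun_def by (metis sup_mono)
    ultimately show ?thesis
      using that by (simp add: is_partition_def)
  qed
  then show ?thesis
    using assms unfolding skew_shape_def by (metis sup_mono)
qed

lemma skew_shape_inf:
  assumes "skew_shape lam mu" "skew_shape nu rho"
  shows "skew_shape (inf lam nu) (inf mu rho)"
proof -
  have "is_partition (inf a b)" if "is_partition a" "is_partition b" for a b
  proof -
    have "{i. inf a b i \<noteq> 0} = {i. a i \<noteq> 0} \<inter> {i. b i \<noteq> 0}"
      by (auto simp: inf_nat_def)
    moreover have "antimono (inf a b)"
      using that unfolding is_partition_def antimono_def inf_fun_def by (metis inf_mono)
    ultimately show ?thesis
      using that by (simp add: is_partition_def)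
  qed
  then show ?thesis
    using assms unfolding skew_shape_def by (metis inf_mono)
qed

end

theory Submission
  imports Defs "HOL-Library.Extended_Nat"
begin

text \<open>
  If the two shapes are nested, both sides are the same product up to the order of the factors.
  Otherwise pairs of tableaux are compared monomial by monomial.

  Extend a tableau of shape \<open>lam / mu\<close> to all of \<open>nat \<times> nat\<close> by the value \<open>0\<close> on the diagram of \<open>mu\<close>
  and \<open>\<infinity>\<close> outside the diagram of \<open>lam\<close>; tableaux become fillings of the quadrant, monotone along
  rows and strictly monotone down columns where the values are proper (\<open>extended_tableau\<close>).  A pair
  \<open>(E, F)\<close> of such fillings and a pair obtained by exchanging \<open>E c\<close> and \<open>F c\<close> at some cells \<open>c\<close>
  have the same total content.  An exchange at only one of two neighbouring cells can destroy
  monotonicity only if the larger value at the first cell does not fit before the smaller value at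
  the second; such neighbours clash.  Clashing depends on the unordered pairs \<open>{E c, F c}\<close> only.

  Call a cell misplaced if it lies in \<open>nu\<close> but not in \<open>lam\<close>, or in \<open>rho\<close> but not in \<open>mu\<close>.  Given
  \<open>(E, F)\<close> of shapes \<open>lam / mu\<close> and \<open>nu / rho\<close>, exchange \<open>E\<close> and \<open>F\<close> on all cells that chains of
  clashes link to a misplaced cell.  On these cells \<open>F\<close> is strictly below \<open>E\<close>, so no cell that is
  misplaced in the opposite sense is touched, and the result has the shapes of the join and the meet
  (\<open>exchange_join\<close>, \<open>exchange_meet\<close>).  The exchanged set can be read off the result, so the map is
  injective, and every coefficient of the left-hand product is at most that of the right-hand one.

  If the shapes are not nested, misplaced cells of both senses exist.  Fill the join shape by small
  numbers and the meet shape by large ones.  Then any two neighbours in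
  \<open>sup lam nu / inf mu rho\<close> clash, so by connectedness the two kinds of misplaced cells are linked.
  Such a pair is not in the image of the injection, and its monomial has different coefficients.
\<close>

section \<open>Tableaux as fillings of the whole quadrant\<close>

text \<open>
  The relation demanded between the value \<open>x\<close> at \<open>c\<close> and the value \<open>y\<close> at \<open>c'\<close>; it is
  trivial unless \<open>c'\<close> is the right or lower neighbour of \<open>c\<close>.  Down a column the boundary values
  \<open>0\<close> and \<open>\<infinity>\<close> may repeat.
\<close>

definition fits :: "nat \<times> nat \<Rightarrow> nat \<times> nat \<Rightarrow> enat \<Rightarrow> enat \<Rightarrow> bool" where
  "fits c c' x y \<longleftrightarrow>
     (c' = (fst c, Suc (snd c)) \<longrightarrow> x \<le> y) \<and>
     (c' = (Suc (fst c), snd c) \<longrightarrow> x < y \<or> x = y \<and> (x = 0 \<or> x = \<infinity>))"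

lemma fits_mono:
  assumes "fits c c' a b" "x \<le> a" "b \<le> y"
  shows "fits c c' x y"
proof -
  have "x < y \<or> x = y \<and> (x = 0 \<or> x = \<infinity>)" if "a < b \<or> a = b \<and> (a = 0 \<or> a = \<infinity>)"
    using that
  proof (elim disjE conjE)
    assume "a < b"
    then show ?thesis using assms by auto
  next
    assume "a = b" "a = 0"
    then show ?thesis using assms by (auto simp: le_less)
  next
    assume "a = b" "a = \<infinity>"
    then show ?thesis using assms by (auto simp: le_less)
  qed
  moreover have "x \<le> y" if "a \<le> b"
    using that assms(2,3) by (meson order_trans)
  ultimately show ?thesis
    using assms(1) unfolding fits_def by blast
qed

definition extended_tableau ::
    "(nat \<Rightarrow> nat) \<Rightarrow> (nat \<Rightarrow> nat) \<Rightarrow> (nat \<times> nat \<Rightarrow> enat) \<Rightarrow> bool" where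
  "extended_tableau lam mu E \<longleftrightarrow>
     (\<forall>c. E c = 0 \<longleftrightarrow> c \<in> diagram mu) \<and> (\<forall>c. E c = \<infinity> \<longleftrightarrow> c \<notin> diagram lam) \<and>
     (\<forall>c c'. fits c c' (E c) (E c'))"

definition extend ::
    "(nat \<Rightarrow> nat) \<Rightarrow> (nat \<Rightarrow> nat) \<Rightarrow> (nat \<times> nat \<Rightarrow> nat) \<Rightarrow> nat \<times> nat \<Rightarrow> enat" where
  "extend lam mu T = (\<lambda>c. if c \<in> diagram mu then 0 else if c \<in> diagram lam then enat (T c) else \<infinity>)"

definition weight :: "(nat \<times> nat \<Rightarrow> enat) \<Rightarrow> nat multiset" where
  "weight E = image_mset (the_enat \<circ> E) (mset_set {c. E c \<noteq> 0 \<and> E c \<noteq> \<infinity>})"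

lemma
  assumes "extended_tableau lam mu E"
  shows extended_tableau_zero: "E c = 0 \<longleftrightarrow> c \<in> diagram mu"
    and extended_tableau_infinity: "E c = \<infinity> \<longleftrightarrow> c \<notin> diagram lam"
    and extended_tableau_fits: "fits c c' (E c) (E c')"
  using assms unfolding extended_tableau_def by blast+

lemmas extended_tableau_values = extended_tableau_zero extended_tableau_infinity

lemma diagram_mono: "mu \<le> lam \<Longrightarrow> diagram mu \<subseteq> diagram lam"
  by (auto simp: diagram_def le_fun_def intro: less_le_trans)

lemma diagram_sup: "diagram (sup lam nu) = diagram lam \<union> diagram nu"
  by (auto simp: diagram_def sup_nat_def less_max_iff_disj)

lemma diagram_inf: "diagram (inf lam nu) = diagram lam \<inter> diagram nu"
  by (auto simp: diagram_def inf_nat_def)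

lemma finite_diagram: "is_partition lam \<Longrightarrow> finite (diagram lam)"
  using finite_skew_diagram[of lam "\<lambda>_. 0"] by (simp add: skew_diagram_def diagram_def)

lemma diagram_up: "is_partition lam \<Longrightarrow> (Suc i, j) \<in> diagram lam \<Longrightarrow> (i, j) \<in> diagram lam"
  by (auto simp: diagram_def is_partition_def antimono_def intro: less_le_trans)

lemma diagram_left: "(i, Suc j) \<in> diagram lam \<Longrightarrow> (i, j) \<in> diagram lam"
  by (auto simp: diagram_def)

lemma extend_is_extended_tableau:
  assumes "skew_shape lam mu"
    and pos: "\<And>c. c \<in> skew_diagram lam mu \<Longrightarrow> 1 \<le> T c"
    and row: "\<And>i j. (i, j) \<in> skew_diagram lam mu \<Longrightarrow> (i, Suc j) \<in> skew_diagram lam mu \<Longrightarrow>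
                T (i, j) \<le> T (i, Suc j)"
    and col: "\<And>i j. (i, j) \<in> skew_diagram lam mu \<Longrightarrow> (Suc i, j) \<in> skew_diagram lam mu \<Longrightarrow>
                T (i, j) < T (Suc i, j)"
  shows "extended_tableau lam mu (extend lam mu T)"
proof -
  let ?E = "extend lam mu T"
  have part: "is_partition lam" "is_partition mu" and sub: "diagram mu \<subseteq> diagram lam"
    using assms(1) diagram_mono by (auto simp: skew_shape_def)
  have "?E c = 0 \<longleftrightarrow> c \<in> diagram mu" for c
    using pos[of c] by (auto simp: extend_def skew_diagram_def zero_enat_def)
  moreover have "?E c = \<infinity> \<longleftrightarrow> c \<notin> diagram lam" for c
    using sub by (auto simp: extend_def)
  moreover have "?E (i, j) \<le> ?E (i, Suc j)" for i j
    using row[of i j] diagram_left[of i j lam] diagram_left[of i j mu]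
    by (auto simp: extend_def skew_diagram_def)
  moreover have "?E (i, j) < ?E (Suc i, j) \<or>
      ?E (i, j) = ?E (Suc i, j) \<and> (?E (i, j) = 0 \<or> ?E (i, j) = \<infinity>)" for i j
    using col[of i j] diagram_up[OF part(1), of i j] diagram_up[OF part(2), of i j] sub
    by (auto simp: extend_def skew_diagram_def zero_enat_def)
  ultimately show ?thesis
    by (auto simp: extended_tableau_def fits_def)
qed

lemma extended_tableau_row_mono:
  assumes "extended_tableau lam mu E" "j \<le> j'"
  shows "E (i, j) \<le> E (i, j')"
proof (rule lift_Suc_mono_le[of "\<lambda>j. E (i, j)", OF _ assms(2)])
  show "E (i, n) \<le> E (i, Suc n)" for n
    using assms(1) by (auto simp: extended_tableau_def fits_def)
qed

lemma extended_tableau_col_mono: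
  assumes "extended_tableau lam mu E" "i \<le> i'"
  shows "E (i, j) \<le> E (i', j)"
proof (rule lift_Suc_mono_le[of "\<lambda>i. E (i, j)", OF _ assms(2)])
  show "E (n, j) \<le> E (Suc n, j)" for n
    using assms(1) unfolding extended_tableau_def fits_def by (metis fst_conv snd_conv le_less)
qed

lemma extended_tableau_col_strict:
  assumes E: "extended_tableau lam mu E" and "i < i'" and "(i, j) \<in> skew_diagram lam mu"
  shows "E (i, j) < E (i', j)"
proof -
  have "E (i, j) \<noteq> 0" "E (i, j) \<noteq> \<infinity>"
    using extended_tableau_values[OF E] assms(3) by (auto simp: skew_diagram_def)
  then have "E (i, j) < E (Suc i, j)"
    using E unfolding extended_tableau_def fits_def by (metis fst_conv snd_conv)
  also have "\<dots> \<le> E (i', j)"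
    using \<open>i < i'\<close> by (intro extended_tableau_col_mono[OF E]) simp
  finally show ?thesis .
qed

lemma extended_tableau_proper_values:
  assumes "extended_tableau lam mu E"
  shows "{c. E c \<noteq> 0 \<and> E c \<noteq> \<infinity>} = skew_diagram lam mu"
  using extended_tableau_values[OF assms] by (auto simp: skew_diagram_def)

lemma weight_extend:
  assumes "skew_shape lam mu" "extended_tableau lam mu (extend lam mu T)"
  shows "weight (extend lam mu T) = content lam mu T"
proof -
  have "finite (skew_diagram lam mu)"
    using assms(1) finite_skew_diagram by (auto simp: skew_shape_def)
  then show ?thesis
    unfolding weight_def content_def extended_tableau_proper_values[OF assms(2)]
    by (intro image_mset_cong) (auto simp: extend_def skew_diagram_def)
qed

lemma bij_betw_ssyt_extended_tableaux:
  assumes skew: "skew_shape lam mu"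
  shows "bij_betw (extend lam mu) {T \<in> ssyt lam mu. content lam mu T = M}
           {E. extended_tableau lam mu E \<and> weight E = M}"
proof (rule bij_betwI')
  let ?D = "skew_diagram lam mu"
  have ext: "extended_tableau lam mu (extend lam mu T)" if "T \<in> ssyt lam mu" for T
    using that by (intro extend_is_extended_tableau[OF skew]) (auto simp: ssyt_def PiE_def Pi_def)
  show "extend lam mu T = extend lam mu T' \<longleftrightarrow> T = T'"
    if "T \<in> {T \<in> ssyt lam mu. content lam mu T = M}" "T' \<in> {T \<in> ssyt lam mu. content lam mu T = M}"
    for T T'
  proof
    assume eq: "extend lam mu T = extend lam mu T'"
    have "T \<in> ?D \<rightarrow>\<^sub>E {1..}" "T' \<in> ?D \<rightarrow>\<^sub>E {1..}"
      using that by (auto simp: ssyt_def)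
    then show "T = T'"
    proof (rule PiE_ext)
      fix c assume "c \<in> ?D"
      then show "T c = T' c"
        using fun_cong[OF eq, of c] by (auto simp: extend_def skew_diagram_def)
    qed
  qed auto
  show "extend lam mu T \<in> {E. extended_tableau lam mu E \<and> weight E = M}"
    if "T \<in> {T \<in> ssyt lam mu. content lam mu T = M}" for T
    using that ext weight_extend[OF skew] by auto
  show "\<exists>T\<in>{T \<in> ssyt lam mu. content lam mu T = M}. E = extend lam mu T"
    if "E \<in> {E. extended_tableau lam mu E \<and> weight E = M}" for E
  proof -
    have E: "extended_tableau lam mu E" and wt: "weight E = M"
      using that by auto
    define T where "T = restrict (the_enat \<circ> E) ?D"
    have val: "E c = enat (T c)" "1 \<le> T c" if "c \<in> ?D" for c
    proof -
      have nz: "E c \<noteq> 0" "E c \<noteq> \<infinity>"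
        using that extended_tableau_proper_values[OF E] by auto
      then show "E c = enat (T c)"
        using that by (auto simp: T_def)
      with nz show "1 \<le> T c"
        by (cases "T c") (auto simp: zero_enat_def)
    qed
    have eq: "E = extend lam mu T"
    proof
      fix c
      show "E c = extend lam mu T c"
        using extended_tableau_values[OF E, of c] val[of c]
        by (auto simp: extend_def skew_diagram_def)
    qed
    have "T \<in> ssyt lam mu"
      unfolding ssyt_def
    proof (intro CollectI conjI allI impI)
      show "T \<in> ?D \<rightarrow>\<^sub>E {1..}"
        using val(2) by (auto simp: T_def)
      show "T (i, j) \<le> T (i, j')" if "(i, j) \<in> ?D" "(i, j') \<in> ?D" "j < j'" for i j j'
        using extended_tableau_row_mono[OF E, of j j' i] val(1)[OF that(1)] val(1)[OF that(2)] that
        by simp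
      show "T (i, j) < T (i', j)" if "(i, j) \<in> ?D" "(i', j) \<in> ?D" "i < i'" for i i' j
        using extended_tableau_col_strict[OF E that(3,1)] val(1)[OF that(1)] val(1)[OF that(2)]
        by simp
    qed
    moreover have "content lam mu T = M"
      using weight_extend[OF skew] E wt eq by simp
    ultimately show ?thesis
      using eq by blast
  qed
qed

text \<open>
  Summing over a set \<open>Q\<close> independent of \<open>E\<close> allows contents of different shapes to be compared cell
  by cell.
\<close>

lemma weight_eq_sum:
  assumes "extended_tableau lam mu E" "diagram lam \<subseteq> Q" "finite Q"
  shows "weight E = (\<Sum>c\<in>Q. if E c = 0 \<or> E c = \<infinity> then {#} else {#the_enat (E c)#})"
proof -
  let ?S = "{c. E c \<noteq> 0 \<and> E c \<noteq> \<infinity>}"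
  have sub: "?S \<subseteq> Q"
    using extended_tableau_values[OF assms(1)] assms(2) by auto
  then have fin: "finite ?S"
    using assms(3) finite_subset by blast
  have "image_mset f (mset_set X) = (\<Sum>c\<in>X. {#f c#})" if "finite X"
    for f :: "nat \<times> nat \<Rightarrow> nat" and X
    using that by induction auto
  then have "weight E = (\<Sum>c\<in>?S. {#the_enat (E c)#})"
    using fin by (simp add: weight_def)
  also have "\<dots> = (\<Sum>c\<in>Q. if E c = 0 \<or> E c = \<infinity> then {#} else {#the_enat (E c)#})"
    using sub assms(3) by (intro sum.mono_neutral_cong_left) auto
  finally show ?thesis .
qed

section \<open>Coefficients of products count pairs\<close>

definition tableau_pairs where
  "tableau_pairs lam mu nu rho M =
     {(E, F). extended_tableau lam mu E \<and> extended_tableau nu rho F \<and> weight E + weight F = M}"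

lemma skew_schur_mult_eq_card:
  assumes "skew_shape lam mu" "skew_shape nu rho"
  shows "finite (tableau_pairs lam mu nu rho M)"
    and "(skew_schur lam mu \<odot> skew_schur nu rho) M = int (card (tableau_pairs lam mu nu rho M))"
proof -
  let ?X = "\<lambda>lam mu A. {E. extended_tableau lam mu E \<and> weight E = A}"
  let ?I = "{(A, B). A + B = M}"
  have X: "finite (?X lam mu A)" "skew_schur lam mu A = int (card (?X lam mu A))"
    if "skew_shape lam mu" for lam mu A
    using bij_betw_ssyt_extended_tableaux[OF that, of A] finite_ssyt_content[of lam mu A] that
    by (auto simp: skew_schur_def skew_shape_def bij_betw_same_card dest: bij_betw_finite)
  have eq: "tableau_pairs lam mu nu rho M = (\<Union>p\<in>?I. ?X lam mu (fst p) \<times> ?X nu rho (snd p))"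
    by (auto simp: tableau_pairs_def)
  show "finite (tableau_pairs lam mu nu rho M)"
    unfolding eq using X(1)[OF assms(1)] X(1)[OF assms(2)] finite_mset_decompositions[of M]
    by (intro finite_UN_I) auto
  have "card (tableau_pairs lam mu nu rho M) =
      (\<Sum>p\<in>?I. card (?X lam mu (fst p) \<times> ?X nu rho (snd p)))"
    unfolding eq using X(1)[OF assms(1)] X(1)[OF assms(2)] finite_mset_decompositions[of M]
    by (intro card_UN_disjoint) auto
  then show "(skew_schur lam mu \<odot> skew_schur nu rho) M = int (card (tableau_pairs lam mu nu rho M))"
    by (simp add: mps_mult_def X(2)[OF assms(1)] X(2)[OF assms(2)] card_cartesian_product
        case_prod_beta)
qed

lemma mps_mult_commute: "f \<odot> g = g \<odot> f"
  unfolding mps_mult_def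
  by (rule ext, rule sum.reindex_bij_witness[of _ prod.swap prod.swap]) (auto simp: add.commute)

section \<open>Exchanging along chains of clashes\<close>

definition clash :: "(nat \<times> nat \<Rightarrow> enat) \<Rightarrow> (nat \<times> nat \<Rightarrow> enat) \<Rightarrow> ((nat \<times> nat) \<times> (nat \<times> nat)) set"
  where "clash E F = {(c, c'). \<not> fits c c' (max (E c) (F c)) (min (E c') (F c'))}"

definition linked :: "(nat \<times> nat) set \<Rightarrow> (nat \<times> nat \<Rightarrow> enat) \<Rightarrow> (nat \<times> nat \<Rightarrow> enat) \<Rightarrow> (nat \<times> nat) set"
  where "linked B E F = (clash E F \<union> (clash E F)\<inverse>)\<^sup>* `` B"

definition exchange :: "'c set \<Rightarrow> ('c \<Rightarrow> 'v) \<Rightarrow> ('c \<Rightarrow> 'v) \<Rightarrow> 'c \<Rightarrow> 'v" where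
  "exchange S E F = (\<lambda>c. if c \<in> S then F c else E c)"

text \<open>
  At these cells the shapes alone force a filling of shape \<open>nu / rho\<close> strictly below one of shape
  \<open>lam / mu\<close>, whereas in a pair of join and meet shape the first filling is the lower one there.
\<close>

definition misplaced ::
    "(nat \<Rightarrow> nat) \<Rightarrow> (nat \<Rightarrow> nat) \<Rightarrow> (nat \<Rightarrow> nat) \<Rightarrow> (nat \<Rightarrow> nat) \<Rightarrow> (nat \<times> nat) set" where
  "misplaced lam mu nu rho = (diagram nu - diagram lam) \<union> (diagram rho - diagram mu)"

lemma exchange_exchange:
  "exchange S (exchange S E F) (exchange S F E) = E"
  by (auto simp: exchange_def)

lemma linked_exchange: "linked B (exchange S E F) (exchange S F E) = linked B E F"
proof -
  have "max (exchange S E F c) (exchange S F E c) = max (E c) (F c)"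
    "min (exchange S E F c) (exchange S F E c) = min (E c) (F c)" for c
    by (simp_all add: exchange_def max.commute min.commute)
  then have "clash (exchange S E F) (exchange S F E) = clash E F"
    by (simp add: clash_def)
  then show ?thesis
    by (simp add: linked_def)
qed

lemma linked_superset: "B \<subseteq> linked B E F"
  by (auto simp: linked_def)

lemma linked_clash: "(c, c') \<in> clash E F \<Longrightarrow> c \<in> linked B E F \<longleftrightarrow> c' \<in> linked B E F"
  unfolding linked_def by (meson Image_iff UnCI converse_iff rtrancl.rtrancl_into_rtrancl)

text \<open>
  If \<open>F\<close> is strictly below \<open>E\<close> at one of two cells but not at the other, the larger value at the
  first and the smaller value at the second belong to the same filling, so the cells do not clash.
\<close>

lemma linked_less:
  assumes E: "\<And>c c'. fits c c' (E c) (E c')" and F: "\<And>c c'. fits c c' (F c) (F c')"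
    and B: "\<And>b. b \<in> B \<Longrightarrow> F b < E b"
    and "c \<in> linked B E F"
  shows "F c < E c"
proof -
  obtain b where "b \<in> B" and path: "(b, c) \<in> (clash E F \<union> (clash E F)\<inverse>)\<^sup>*"
    using assms(4) by (auto simp: linked_def)
  from path show ?thesis
  proof induction
    case base
    then show ?case using B \<open>b \<in> B\<close> by blast
  next
    case (step x y)
    show ?case
    proof (rule ccontr)
      assume "\<not> F y < E y"
      then have "E y \<le> F y" by simp
      with step.IH E[of x y] F[of y x] have "fits x y (max (E x) (F x)) (min (E y) (F y))"
        "fits y x (max (E y) (F y)) (min (E x) (F x))"
        by (simp_all add: max_absorb1 max_absorb2 min_absorb1 min_absorb2 less_imp_le)
      with step.hyps show False by (auto simp: clash_def)
    qed
  qed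
qed

lemma exchange_fits:
  assumes "\<And>c c'. fits c c' (E c) (E c')" and "\<And>c c'. fits c c' (F c) (F c')"
    and closed: "\<And>c c'. (c, c') \<in> clash E F \<Longrightarrow> c \<in> S \<longleftrightarrow> c' \<in> S"
  shows "fits c c' (exchange S E F c) (exchange S E F c')"
proof (cases "c \<in> S \<longleftrightarrow> c' \<in> S")
  case True
  then show ?thesis using assms(1,2) by (auto simp: exchange_def)
next
  case False
  then have "fits c c' (max (E c) (F c)) (min (E c') (F c'))"
    using closed[of c c'] unfolding clash_def by blast
  then show ?thesis
    by (rule fits_mono) (auto simp: exchange_def)
qed

lemma misplaced_less:
  assumes "extended_tableau lam mu E" "extended_tableau nu rho F" "c \<in> misplaced lam mu nu rho"
  shows "F c < E c"
proof -
  have "F c \<noteq> \<infinity> \<and> E c = \<infinity> \<or> F c = 0 \<and> E c \<noteq> 0"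
    using extended_tableau_values[OF assms(1)] extended_tableau_values[OF assms(2)] assms(3)
    by (auto simp: misplaced_def)
  then show ?thesis
    by (cases "F c"; cases "E c") (auto simp: zero_enat_def)
qed

text \<open>
  By \<open>linked_less\<close>, \<open>F\<close> is strictly below \<open>E\<close> on the linked cells, whereas the shapes force \<open>E\<close>
  strictly below \<open>F\<close> at cells misplaced in the opposite sense.  So an exchange on the linked cells
  moves the values \<open>0\<close> and \<open>\<infinity>\<close> exactly where the join and the meet require it.
\<close>

lemma linked_not_misplaced:
  assumes "extended_tableau lam mu E" "extended_tableau nu rho F"
  shows "linked (misplaced lam mu nu rho) E F \<inter> misplaced nu rho lam mu = {}"
proof -
  have "F c < E c" if "c \<in> linked (misplaced lam mu nu rho) E F" for c
    by (rule linked_less[OF extended_tableau_fits[OF assms(1)] extended_tableau_fits[OF assms(2)]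
          misplaced_less[OF assms] that])
  then show ?thesis
    using misplaced_less[OF assms(2,1)] by fastforce
qed

lemma exchange_join:
  assumes E: "extended_tableau lam mu E" and F: "extended_tableau nu rho F"
  defines "S \<equiv> linked (misplaced lam mu nu rho) E F"
  shows "extended_tableau (sup lam nu) (sup mu rho) (exchange S E F)"
proof -
  have in_S: "misplaced lam mu nu rho \<subseteq> S" and out_S: "S \<inter> misplaced nu rho lam mu = {}"
    using linked_superset linked_not_misplaced[OF E F] by (auto simp: S_def)
  have "fits c c' (exchange S E F c) (exchange S E F c')" for c c'
    by (rule exchange_fits)
      (use extended_tableau_fits[OF E] extended_tableau_fits[OF F] linked_clash
        in \<open>auto simp: S_def\<close>)
  moreover have "exchange S E F c = 0 \<longleftrightarrow> c \<in> diagram (sup mu rho)"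
    "exchange S E F c = \<infinity> \<longleftrightarrow> c \<notin> diagram (sup lam nu)" for c
    using extended_tableau_values[OF E, of c] extended_tableau_values[OF F, of c] in_S out_S
    by (auto simp: exchange_def misplaced_def diagram_sup)
  ultimately show ?thesis
    by (simp add: extended_tableau_def)
qed

lemma exchange_meet:
  assumes E: "extended_tableau lam mu E" and F: "extended_tableau nu rho F"
  defines "S \<equiv> linked (misplaced lam mu nu rho) E F"
  shows "extended_tableau (inf lam nu) (inf mu rho) (exchange S F E)"
proof -
  have in_S: "misplaced lam mu nu rho \<subseteq> S" and out_S: "S \<inter> misplaced nu rho lam mu = {}"
    using linked_superset linked_not_misplaced[OF E F] by (auto simp: S_def)
  have "clash F E = clash E F"
    by (simp add: clash_def max.commute min.commute)
  then have "fits c c' (exchange S F E c) (exchange S F E c')" for c c'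
    by (intro exchange_fits)
      (use extended_tableau_fits[OF E] extended_tableau_fits[OF F] linked_clash
        in \<open>auto simp: S_def\<close>)
  moreover have "exchange S F E c = 0 \<longleftrightarrow> c \<in> diagram (inf mu rho)"
    "exchange S F E c = \<infinity> \<longleftrightarrow> c \<notin> diagram (inf lam nu)" for c
    using extended_tableau_values[OF E, of c] extended_tableau_values[OF F, of c] in_S out_S
    by (auto simp: exchange_def misplaced_def diagram_inf)
  ultimately show ?thesis
    by (simp add: extended_tableau_def)
qed

lemma weight_exchange:
  assumes "extended_tableau lam mu E" "extended_tableau nu rho F"
    and "extended_tableau lam' mu' (exchange S E F)" "extended_tableau nu' rho' (exchange S F E)"
    and "finite (diagram lam)" "finite (diagram nu)" "finite (diagram lam')" "finite (diagram nu')"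
  shows "weight (exchange S E F) + weight (exchange S F E) = weight E + weight F"
proof -
  define Q where "Q = diagram lam \<union> diagram nu \<union> diagram lam' \<union> diagram nu'"
  have Q: "finite Q" "diagram lam \<subseteq> Q" "diagram nu \<subseteq> Q" "diagram lam' \<subseteq> Q" "diagram nu' \<subseteq> Q"
    using assms(5-8) by (auto simp: Q_def)
  show ?thesis
    unfolding weight_eq_sum[OF assms(1) Q(2,1)] weight_eq_sum[OF assms(2) Q(3,1)]
      weight_eq_sum[OF assms(3) Q(4,1)] weight_eq_sum[OF assms(4) Q(5,1)] sum.distrib[symmetric]
    by (intro sum.cong) (auto simp: exchange_def)
qed

definition transfer where
  "transfer lam mu nu rho = (\<lambda>(E, F).
     let S = linked (misplaced lam mu nu rho) E F in (exchange S E F, exchange S F E))"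

text \<open>
  The exchanged set is the same before and after the exchange, so a second transfer with the same
  parameters undoes the first.
\<close>

lemma inj_transfer: "inj (transfer lam mu nu rho)"
proof (rule inj_on_inverseI)
  show "transfer lam mu nu rho (transfer lam mu nu rho p) = p" for p
    by (cases p) (simp add: transfer_def Let_def linked_exchange exchange_exchange)
qed

lemma transfer_tableau_pairs:
  assumes skew: "skew_shape lam mu" "skew_shape nu rho"
    and p: "p \<in> tableau_pairs lam mu nu rho M"
  shows "transfer lam mu nu rho p \<in>
           tableau_pairs (sup lam nu) (sup mu rho) (inf lam nu) (inf mu rho) M"
proof -
  obtain E F where pE: "p = (E, F)" by fastforce
  have E: "extended_tableau lam mu E" and F: "extended_tableau nu rho F"
    and M: "weight E + weight F = M"
    using p by (auto simp: pE tableau_pairs_def)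
  have "finite (diagram lam)" "finite (diagram nu)"
    "finite (diagram (sup lam nu))" "finite (diagram (inf lam nu))"
    using skew finite_diagram by (auto simp: skew_shape_def diagram_sup diagram_inf)
  then show ?thesis
    using exchange_join[OF E F] exchange_meet[OF E F] weight_exchange[OF E F] M
    by (simp add: pE transfer_def tableau_pairs_def Let_def)
qed

section \<open>A pair in which all neighbours clash\<close>

lemma extended_tableau_rows:
  assumes "skew_shape lam mu"
  shows "extended_tableau lam mu (extend lam mu (\<lambda>c. k + Suc (fst c)))"
  by (rule extend_is_extended_tableau[OF assms]) auto

text \<open>
  The condition on \<open>k\<close> says that \<open>k\<close> bounds the number of rows.  Hence on the diagram of \<open>sup lam nu\<close>
  the smaller value is at most \<open>k\<close>, and off the diagram of \<open>inf mu rho\<close> the larger one exceeds \<open>k\<close>;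
  the latter includes cells whose larger value is \<open>\<infinity>\<close>.
\<close>

lemma linked_everything:
  assumes conn: "rook_connected (skew_diagram (sup lam nu) (inf mu rho))"
    and rows: "\<And>i. k \<le> i \<Longrightarrow> sup lam nu i = 0"
    and "b \<in> B" "b \<in> skew_diagram (sup lam nu) (inf mu rho)"
  shows "skew_diagram (sup lam nu) (inf mu rho) \<subseteq>
           linked B (extend (sup lam nu) (sup mu rho) (\<lambda>c. 0 + Suc (fst c)))
                    (extend (inf lam nu) (inf mu rho) (\<lambda>c. k + Suc (fst c)))"
    (is "?D \<subseteq> linked B ?E ?F")
proof
  fix a assume "a \<in> ?D"
  have clash: "(c, c') \<in> clash ?E ?F"
    if "c \<in> ?D" "c' \<in> ?D" "c' = (fst c, Suc (snd c)) \<or> c' = (Suc (fst c), snd c)" for c c'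
  proof -
    have "fst c' < k"
    proof (rule ccontr)
      assume "\<not> fst c' < k"
      then have "sup lam nu (fst c') = 0" using rows by simp
      then show False using that(2) by (auto simp: skew_diagram_def diagram_def)
    qed
    then have "min (?E c') (?F c') \<le> enat k"
      using that(2) by (auto simp: min_le_iff_disj extend_def skew_diagram_def zero_enat_def)
    moreover have "enat k < max (?E c) (?F c)"
      using that(1) by (auto simp: less_max_iff_disj extend_def skew_diagram_def)
    ultimately have "min (?E c') (?F c') < max (?E c) (?F c)"
      by (rule le_less_trans)
    moreover have "x \<le> y" if "fits c c' x y" for x y
      using that \<open>c' = _ \<or> c' = _\<close> unfolding fits_def by (metis le_less)
    ultimately show ?thesis
      unfolding clash_def using leD by blast
  qed
  have "{(a, b). a \<in> ?D \<and> b \<in> ?D \<and> share_edge a b} \<subseteq> clash ?E ?F \<union> (clash ?E ?F)\<inverse>"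
    using clash by (auto 4 3)
  then have "(b, a) \<in> (clash ?E ?F \<union> (clash ?E ?F)\<inverse>)\<^sup>*"
    using conn assms(4) \<open>a \<in> ?D\<close> rtrancl_mono unfolding rook_connected_def by blast
  then show "a \<in> linked B ?E ?F"
    using \<open>b \<in> B\<close> by (auto simp: linked_def)
qed

lemma misplaced_nonempty:
  assumes "\<not> (nu \<le> lam \<and> rho \<le> mu)"
  shows "misplaced lam mu nu rho \<noteq> {}"
proof -
  have "\<exists>c. c \<in> diagram b - diagram a" if "\<not> b \<le> a" for a b
    using that by (auto simp: le_fun_def diagram_def not_le)
  then show ?thesis
    using assms unfolding misplaced_def by blast
qed

lemma misplaced_subset:
  assumes "skew_shape lam mu" "skew_shape nu rho"
  shows "misplaced lam mu nu rho \<subseteq> skew_diagram (sup lam nu) (inf mu rho)"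
  using assms diagram_mono[of mu lam] diagram_mono[of rho nu]
  by (auto simp: skew_shape_def misplaced_def skew_diagram_def diagram_sup diagram_inf)

lemma skew_schur_mult_strict:
  assumes skew: "skew_shape lam mu" "skew_shape nu rho"
    and conn: "rook_connected (skew_diagram (sup lam nu) (inf mu rho))"
    and not_nested: "\<not> (lam \<le> nu \<and> mu \<le> rho)" "\<not> (nu \<le> lam \<and> rho \<le> mu)"
  shows "\<exists>M. (skew_schur lam mu \<odot> skew_schur nu rho) M <
           (skew_schur (sup lam nu) (sup mu rho) \<odot> skew_schur (inf lam nu) (inf mu rho)) M"
proof -
  note skew' = skew_shape_sup[OF skew] skew_shape_inf[OF skew]
  let ?B = "misplaced lam mu nu rho"
  obtain a b where a: "a \<in> misplaced nu rho lam mu" and b: "b \<in> ?B"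
    using misplaced_nonempty not_nested by blast
  have "finite {i. sup lam nu i \<noteq> 0}"
    using skew'(1) by (simp add: skew_shape_def is_partition_def)
  then obtain k where k: "\<And>i. k \<le> i \<Longrightarrow> sup lam nu i = 0"
    using finite_nat_set_iff_bounded[of "{i. sup lam nu i \<noteq> 0}"]
    by (metis (mono_tags, lifting) mem_Collect_eq not_le)
  define U V where "U = extend (sup lam nu) (sup mu rho) (\<lambda>c. 0 + Suc (fst c))"
    and "V = extend (inf lam nu) (inf mu rho) (\<lambda>c. k + Suc (fst c))"
  define M where "M = weight U + weight V"
  let ?L = "tableau_pairs lam mu nu rho M"
  let ?R = "tableau_pairs (sup lam nu) (sup mu rho) (inf lam nu) (inf mu rho) M"
  let ?f = "transfer lam mu nu rho"
  have UV: "(U, V) \<in> ?R"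
    unfolding tableau_pairs_def U_def V_def M_def
    using extended_tableau_rows[OF skew'(1)] extended_tableau_rows[OF skew'(2)] by blast
  have "a \<in> linked ?B U V"
    using linked_everything[OF conn k b] misplaced_subset[OF skew]
      misplaced_subset[OF skew(2,1)] a b
    by (auto simp: U_def V_def sup.commute inf.commute)
  \<comment> \<open>A preimage would have the same clashes, hence the cell \<open>a\<close> linked to \<open>b\<close> as well, although the
    two are misplaced in opposite senses.\<close>
  have "(U, V) \<notin> ?f ` ?L"
  proof
    assume "(U, V) \<in> ?f ` ?L"
    then obtain E F where EF: "(E, F) \<in> ?L" and "(U, V) = ?f (E, F)"
      by auto
    then have "linked ?B U V = linked ?B E F"
      by (simp add: transfer_def Let_def linked_exchange)
    then show False
      using \<open>a \<in> linked ?B U V\<close> a EF linked_not_misplaced[of lam mu E nu rho F]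
      by (auto simp: tableau_pairs_def)
  qed
  then have "?f ` ?L \<subset> ?R"
    using transfer_tableau_pairs[OF skew] UV by blast
  then have "card (?f ` ?L) < card ?R"
    by (intro psubset_card_mono skew_schur_mult_eq_card(1)[OF skew'])
  moreover have "card (?f ` ?L) = card ?L"
    by (intro card_image inj_on_subset[OF inj_transfer]) auto
  ultimately show ?thesis
    using skew_schur_mult_eq_card(2)[OF skew] skew_schur_mult_eq_card(2)[OF skew'] by force
qed

theorem theorem3p3:
  fixes lam mu nu rho :: "nat \<Rightarrow> nat"
  assumes "skew_shape lam mu" and "skew_shape nu rho"
    and "rook_connected (skew_diagram (sup lam nu) (inf mu rho))"
  shows "skew_schur lam mu \<odot> skew_schur nu rho =
           skew_schur (sup lam nu) (sup mu rho) \<odot> skew_schur (inf lam nu) (inf mu rho)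
         \<longleftrightarrow> (lam \<le> nu \<and> mu \<le> rho) \<or> (nu \<le> lam \<and> rho \<le> mu)"
proof
  assume "skew_schur lam mu \<odot> skew_schur nu rho =
    skew_schur (sup lam nu) (sup mu rho) \<odot> skew_schur (inf lam nu) (inf mu rho)"
  then show "(lam \<le> nu \<and> mu \<le> rho) \<or> (nu \<le> lam \<and> rho \<le> mu)"
    using skew_schur_mult_strict[OF assms] by (metis less_irrefl)
next
  assume "(lam \<le> nu \<and> mu \<le> rho) \<or> (nu \<le> lam \<and> rho \<le> mu)"
  then show "skew_schur lam mu \<odot> skew_schur nu rho =
    skew_schur (sup lam nu) (sup mu rho) \<odot> skew_schur (inf lam nu) (inf mu rho)"
    by (auto simp: sup_absorb1 sup_absorb2 inf_absorb1 inf_absorb2 mps_mult_commute)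
qed

end
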